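(* Let $X$ be a Banach space, let $C\subseteq X$ be a closed, bounded, convex, non-singleton, non-empty set, and let $\mathcal{M}=\mathcal{M}(C)$ denote the space of non-expansive mappings $C\to C$ equipped with the supremum metric. Then there is a $\sigma$-lower porous subset $\mathcal{N}$ of $\mathcal{M}$ such that for every $f\in \mathcal{M}\setminus \mathcal{N}$ the set $$R(f):=\{x\in C\colon \operatorname{Lip}(f,x)=1\}$$ is a residual subset of $C$.
   Context: A mapping $f\colon C\to C$ is non-expansive if $\|f(y)-f(x)\|\le\|y-x\|$ for all $x,y\in C$. $\mathcal{M}(C)$ is the set of all non-expansive mappings $C\to C$, with metric $d_\infty(f,g)=\|g-f\|_\infty=\sup_{x\in C}\|g(x)-f(x)\|$. For $f\colon C\to C$ and $x\in C$, $$\operatorname{Lip}(f,x):=\lim_{r\to 0}\sup\left\{\frac{\|f(y)-f(x)\|}{\|y-x\|}\colon y\in C,\ 0<\|y-x\|\le r\right\}.$$ Porosity: for a metric space $(M,d)$, $P\subseteq M$, $x\in M$, $r>0$, let $B_M(x,r)$ be the open ball and $$\gamma(x,r,P):=\sup\{s>0\colon \exists x'\in M\text{ such that }B_M(x',s)\subseteq B_M(x,r)\setminus P\},$$ with $\sup\emptyset=-\infty$. $P$ is lower porous at $x$ if $\gamma(x,r,P)>0$ for all $r>0$ and $\liminf_{r\to 0}\gamma(x,r,P)/r>0$. $P$ is lower porous if it is lower porous at every $x\in P$. A set is $\sigma$-lower porous if it is a countable union of lower porous sets. A subset of $C$ is residual if its complement in $C$ is a countable union of nowhere dense subsets of $C$.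 *)

theory Defs
  imports "HOL-Analysis.Analysis"
begin

text \<open>The supremum is taken in the extended reals, where \<^term>\<open>Sup {} = (-\<infinity> :: ereal)\<close>.\<close>

definition porosity_radius :: "'a metric \<Rightarrow> 'a \<Rightarrow> real \<Rightarrow> 'a set \<Rightarrow> ereal" where
  "porosity_radius m x r P =
     Sup {ereal s | s. 0 < s \<and> (\<exists>x' \<in> mspace m. mball_of m x' s \<subseteq> mball_of m x r - P)}"

definition lower_porous_at :: "'a metric \<Rightarrow> 'a set \<Rightarrow> 'a \<Rightarrow> bool" where
  "lower_porous_at m P x \<longleftrightarrow>
     (\<forall>r>0. porosity_radius m x r P > 0) \<and>
     Liminf (at_right 0) (\<lambda>r. porosity_radius m x r P / ereal r) > 0"

definition lower_porous :: "'a metric \<Rightarrow> 'a set \<Rightarrow> bool" where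
  "lower_porous m P \<longleftrightarrow> P \<subseteq> mspace m \<and> (\<forall>x\<in>P. lower_porous_at m P x)"

definition sigma_lower_porous :: "'a metric \<Rightarrow> 'a set \<Rightarrow> bool" where
  "sigma_lower_porous m N \<longleftrightarrow>
     (\<exists>\<P>. countable \<P> \<and> (\<forall>P\<in>\<P>. lower_porous m P) \<and> N = \<Union>\<P>)"

definition nowhere_dense_in :: "'a topology \<Rightarrow> 'a set \<Rightarrow> bool" where
  "nowhere_dense_in X S \<longleftrightarrow> S \<subseteq> topspace X \<and> X interior_of (X closure_of S) = {}"

definition residual_in :: "'a topology \<Rightarrow> 'a set \<Rightarrow> bool" where
  "residual_in X S \<longleftrightarrow> S \<subseteq> topspace X \<and>
     (\<exists>\<N>. countable \<N> \<and> (\<forall>A\<in>\<N>. nowhere_dense_in X A) \<and> topspace X - S = \<Union>\<N>)"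

text \<open>
  Elements of \<^const>\<open>funspace\<close> are bounded functions that are extensional on the domain \<open>C\<close>,
  so that maps on \<open>C\<close> are identified with their values on \<open>C\<close>; the metric is the supremum
  metric. When \<open>C\<close> is bounded the boundedness requirement is vacuous; see the two lemmas below.
\<close>

definition nonexpansive_space :: "'a::real_normed_vector set \<Rightarrow> ('a \<Rightarrow> 'a) metric" where
  "nonexpansive_space C =
     submetric (funspace C (submetric euclidean_metric C)) {f. 1-lipschitz_on C f}"

lemma mspace_nonexpansive_space:
  fixes C :: "'a::real_normed_vector set"
  assumes "bounded C"
  shows "mspace (nonexpansive_space C) =
    {f \<in> C \<rightarrow>\<^sub>E C. \<forall>x\<in>C. \<forall>y\<in>C. norm (f y - f x) \<le> norm (y - x)}"
proof -
  interpret S: Submetric UNIV dist C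
    by unfold_locales auto
  have bdd: "S.sub.mbounded (f ` C)" if "f ` C \<subseteq> C" for f :: "'a \<Rightarrow> 'a"
    using that assms bounded_subset[OF assms that]
    by (simp add: S.mbounded_submetric)
  show ?thesis
    using bdd unfolding nonexpansive_space_def S.sub.fspace_def
    by (auto simp: S.sub.fspace_def lipschitz_on_def dist_norm norm_minus_commute
        PiE_def extensional_def Pi_def image_subset_iff)
qed

lemma mdist_nonexpansive_space:
  fixes C :: "'a::real_normed_vector set"
  assumes "C \<noteq> {}" "f \<in> mspace (nonexpansive_space C)" "g \<in> mspace (nonexpansive_space C)"
  shows "mdist (nonexpansive_space C) f g = (SUP x\<in>C. norm (g x - f x))"
proof -
  interpret S: Submetric UNIV dist C
    by unfold_locales auto
  show ?thesis
    using assms unfolding nonexpansive_space_def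
    by (simp add: S.sub.fdist_def dist_norm norm_minus_commute)
qed

definition lip_sup :: "'a::real_normed_vector set \<Rightarrow> ('a \<Rightarrow> 'a) \<Rightarrow> 'a \<Rightarrow> real \<Rightarrow> ereal" where
  "lip_sup C f x r =
     Sup {ereal (norm (f y - f x) / norm (y - x)) | y. y \<in> C \<and> 0 < norm (y - x) \<and> norm (y - x) \<le> r}"

definition Lip :: "'a::real_normed_vector set \<Rightarrow> ('a \<Rightarrow> 'a) \<Rightarrow> 'a \<Rightarrow> ereal" where
  "Lip C f x = Lim (at_right 0) (lip_sup C f x)"

text \<open>The limit always exists in the extended reals, by monotonicity in \<open>r\<close>.\<close>

lemma lip_sup_tendsto_Lip: "(lip_sup C f x \<longlongrightarrow> Lip C f x) (at_right 0)"
proof -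
  have mono: "lip_sup C f x r \<le> lip_sup C f x s" if "r \<le> s" for r s
    unfolding lip_sup_def using that by (intro Sup_subset_mono) force
  have "(lip_sup C f x \<longlongrightarrow> (INF r\<in>{0<..}. lip_sup C f x r)) (at_right 0)"
  proof (rule order_tendstoI)
    fix a assume "a < (INF r\<in>{0<..}. lip_sup C f x r)"
    then have "a < lip_sup C f x r" if "0 < r" for r
      using that by (metis INF_lower greaterThan_iff less_le_trans)
    then show "\<forall>\<^sub>F r in at_right 0. a < lip_sup C f x r"
      by (auto simp: eventually_at_right_less eventually_at_filter)
  next
    fix a assume "(INF r\<in>{0<..}. lip_sup C f x r) < a"
    then obtain s where "0 < s" "lip_sup C f x s < a"
      by (auto simp: INF_less_iff)
    then show "\<forall>\<^sub>F r in at_right 0. lip_sup C f x r < a"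
      unfolding eventually_at_right_field
      by (intro exI[of _ s]) (meson le_less_trans less_imp_le mono)
  qed
  then show ?thesis
    unfolding Lip_def by (metis tendsto_Lim trivial_limit_at_right_real)
qed

end

theory Submission
  imports Defs
begin

text \<open>
  If \<open>Lip C f x < 1\<close> on a set that is not meagre, then \<open>f\<close> is \<open>\<beta>\<close>-Lipschitz with \<open>\<beta> < 1\<close> on
  some ball of some radius \<open>\<rho>\<close>, where \<open>\<beta>\<close> and \<open>\<rho>\<close> may be taken from countable sets. For fixed
  \<open>\<beta>\<close> and \<open>\<rho>\<close> the set of these maps is lower porous. Given \<open>f\<close> and a small \<open>r\<close>, contract \<open>f\<close>
  towards a point to get a \<open>(1 - \<delta>)\<close>-Lipschitz map with \<open>\<delta>\<close> proportional to \<open>r\<close>. This leaves room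
  to precompose with a \<open>(1 + \<delta>)\<close>-Lipschitz map that collapses a ball of radius \<open>s\<close> around each
  point of a maximal \<open>\<rho> / 2\<close>-separated set and is the identity at distance \<open>\<rho> / 8\<close> from that
  set, with \<open>s\<close> still proportional to \<open>r\<close>. On the collapsed balls one may add cones of slope one.
  The result has slope one at distance \<open>s\<close> in every ball of radius \<open>\<rho>\<close>, and every map within a
  small multiple of \<open>s\<close> has slopes above \<open>\<beta>\<close> there. The centre of the ball is never fixed, so
  separability is not needed.
\<close>

section \<open>Separated sets and Lipschitz bounds on convex sets\<close>

text \<open>Zorn's lemma: a point of \<open>C\<close> at distance at least \<open>\<tau>\<close>
  from a maximal separated set could be added to it.\<close>

lemma maximal_separated_set:
  fixes C :: "'a::metric_space set"
  assumes "\<tau> > 0"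
  obtains \<Gamma> where "\<Gamma> \<subseteq> C"
    and "\<And>p q. p \<in> \<Gamma> \<Longrightarrow> q \<in> \<Gamma> \<Longrightarrow> p \<noteq> q \<Longrightarrow> \<tau> \<le> dist p q"
    and "\<And>x. x \<in> C \<Longrightarrow> \<exists>p\<in>\<Gamma>. dist x p < \<tau>"
proof -
  define \<A> where "\<A> = {A. A \<subseteq> C \<and> (\<forall>p\<in>A. \<forall>q\<in>A. p \<noteq> q \<longrightarrow> \<tau> \<le> dist p q)}"
  have "\<exists>U\<in>\<A>. \<forall>A\<in>\<C>. A \<subseteq> U" if chain: "subset.chain \<A> \<C>" for \<C>
  proof (intro bexI[of _ "\<Union>\<C>"] ballI)
    have sub: "\<C> \<subseteq> \<A>" and tot: "\<And>A B. A \<in> \<C> \<Longrightarrow> B \<in> \<C> \<Longrightarrow> A \<subseteq> B \<or> B \<subseteq> A"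
      using chain by (auto simp: subset_chain_def)
    have "\<tau> \<le> dist p q" if pq: "p \<in> A" "A \<in> \<C>" "q \<in> B" "B \<in> \<C>" "p \<noteq> q" for p q A B
    proof -
      obtain E where "E \<in> \<C>" "p \<in> E" "q \<in> E"
        using tot[of A B] pq by blast
      then show ?thesis using sub \<open>p \<noteq> q\<close> by (auto simp: \<A>_def)
    qed
    then show "\<Union>\<C> \<in> \<A>" using sub by (auto simp: \<A>_def)
  qed auto
  then have "\<exists>\<Gamma>\<in>\<A>. \<forall>A\<in>\<A>. \<Gamma> \<subseteq> A \<longrightarrow> A = \<Gamma>"
    by (rule subset_Zorn)
  then obtain \<Gamma> where \<Gamma>: "\<Gamma> \<in> \<A>" and max: "\<And>A. A \<in> \<A> \<Longrightarrow> \<Gamma> \<subseteq> A \<Longrightarrow> A = \<Gamma>"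
    by auto
  have "\<exists>p\<in>\<Gamma>. dist x p < \<tau>" if "x \<in> C" for x
  proof (rule ccontr)
    assume *: "\<not> ?thesis"
    then have "insert x \<Gamma> \<in> \<A>"
      using \<Gamma> that by (auto simp: \<A>_def not_less dist_commute)
    then have "x \<in> \<Gamma>" using max[of "insert x \<Gamma>"] by auto
    then show False using * assms by auto
  qed
  then show thesis using \<Gamma> that by (auto simp: \<A>_def)
qed

text \<open>Cut the segment from \<open>x\<close> to \<open>y\<close> into equal pieces shorter than
  \<open>\<epsilon>\<close>; their lengths add up to exactly \<open>norm (y - x)\<close>.\<close>

lemma convex_lipschitz_local_to_global:
  fixes f :: "'a::real_normed_vector \<Rightarrow> 'b::real_normed_vector"
  assumes "convex C" "\<epsilon> > 0"
    and loc: "\<And>x y. x \<in> C \<Longrightarrow> y \<in> C \<Longrightarrow> norm (y - x) < \<epsilon> \<Longrightarrow> norm (f y - f x) \<le> L * norm (y - x)"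
    and xy: "x \<in> C" "y \<in> C"
  shows "norm (f y - f x) \<le> L * norm (y - x)"
proof -
  obtain n :: nat where n: "norm (y - x) / \<epsilon> < real n" using reals_Archimedean2 by blast
  have n0: "n > 0" using n \<open>\<epsilon> > 0\<close>
    by (metis divide_nonneg_pos gr0I norm_ge_zero not_less of_nat_0)
  define z where "z k = x + (real k / real n) *\<^sub>R (y - x)" for k
  have zC: "z k \<in> C" if "k \<le> n" for k
  proof -
    have "z k = (1 - real k / real n) *\<^sub>R x + (real k / real n) *\<^sub>R y"
      by (simp add: z_def algebra_simps)
    then show ?thesis using convexD_alt[OF \<open>convex C\<close> xy, of "real k / real n"] that n0 by auto
  qed
  have zd: "norm (z (Suc k) - z k) = norm (y - x) / n" for k
  proof -
    have "z (Suc k) - z k = (1 / real n) *\<^sub>R (y - x)"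
      by (simp add: z_def add_divide_distrib scaleR_left_distrib)
    then show ?thesis by simp
  qed
  have small: "norm (y - x) / n < \<epsilon>" using n n0 \<open>\<epsilon> > 0\<close> by (simp add: field_simps)
  have "norm (f (z k) - f x) \<le> L * (real k * (norm (y - x) / n))" if "k \<le> n" for k
    using that
  proof (induction k)
    case 0
    then show ?case by (simp add: z_def)
  next
    case (Suc k)
    have "norm (f (z (Suc k)) - f (z k)) \<le> L * (norm (y - x) / n)"
      using loc[of "z k" "z (Suc k)"] zC[of k] zC[of "Suc k"] Suc.prems small by (simp add: zd)
    moreover have "norm (f (z k) - f x) \<le> L * (real k * (norm (y - x) / n))"
      using Suc by simp
    moreover have "norm (f (z (Suc k)) - f x) \<le> norm (f (z (Suc k)) - f (z k)) + norm (f (z k) - f x)"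
      by (metis diff_add_cancel add_diff_eq norm_triangle_ineq)
    ultimately show ?case by (simp add: algebra_simps add_divide_distrib)
  qed
  from this[of n] show ?thesis using n0 by (simp add: z_def)
qed

section \<open>Flattening a map near a point and adding a cone\<close>

text \<open>Multiplying \<open>v\<close> by this factor at \<open>t = norm v\<close> is the soft
  threshold at \<open>s\<close>, enlarged by \<open>1 + \<delta>\<close> so that it catches up with
  the identity at a finite distance, where the cap at 1 takes over.\<close>

definition flatten_factor :: "real \<Rightarrow> real \<Rightarrow> real \<Rightarrow> real" where
  "flatten_factor \<delta> s t = (if t \<le> s then 0 else min 1 ((1 + \<delta>) * (1 - s / t)))"

lemma flatten_factor_bounds:
  assumes "\<delta> \<ge> 0" "s > 0"
  shows "0 \<le> flatten_factor \<delta> s t" "flatten_factor \<delta> s t \<le> 1"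
  using assms by (auto simp: flatten_factor_def)

lemma flatten_factor_eq_1:
  assumes "\<delta> > 0" "s > 0" "(1 + \<delta>) * s / \<delta> \<le> t"
  shows "flatten_factor \<delta> s t = 1"
proof -
  have "(1 + \<delta>) * s \<le> \<delta> * t" using assms by (simp add: field_simps)
  moreover have "t > s"
  proof -
    have "(1 + \<delta>) * s = s + \<delta> * s" by (simp add: algebra_simps)
    then have "\<delta> * s < \<delta> * t" using calculation \<open>s > 0\<close> by linarith
    then show ?thesis using \<open>\<delta> > 0\<close> by (simp only: mult_less_cancel_left_pos)
  qed
  ultimately have "1 \<le> (1 + \<delta>) * (1 - s / t)" using assms by (simp add: field_simps)
  then show ?thesis using \<open>t > s\<close> by (simp add: flatten_factor_def)
qed

lemma flatten_factor_times_le: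
  assumes "\<delta> \<ge> 0" "s > 0" "t > s"
  shows "flatten_factor \<delta> s t * t \<le> (1 + \<delta>) * (t - s)"
proof -
  have "flatten_factor \<delta> s t * t \<le> ((1 + \<delta>) * (1 - s / t)) * t"
    using assms by (intro mult_right_mono) (auto simp: flatten_factor_def)
  also have "\<dots> = (1 + \<delta>) * (t - s)" using assms by (simp add: field_simps)
  finally show ?thesis .
qed

text \<open>The plain soft threshold shortens a vector by exactly \<open>s\<close>; the factor
  \<open>1 + \<delta>\<close> only makes it shorten less.\<close>

lemma flatten_factor_displacement:
  assumes "\<delta> \<ge> 0" "s > 0" "t > s"
  shows "(1 - flatten_factor \<delta> s t) * t \<le> s"
proof -
  have "1 - s / t \<le> (1 + \<delta>) * (1 - s / t)"
    using assms by (intro mult_right_mono[of 1 "1 + \<delta>", simplified]) auto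
  then have "1 - s / t \<le> flatten_factor \<delta> s t"
    using assms by (simp add: flatten_factor_def)
  then have "(1 - flatten_factor \<delta> s t) * t \<le> (s / t) * t"
    using assms by (intro mult_right_mono) auto
  then show ?thesis using assms by simp
qed

text \<open>
  The bound is independent of the norm because the soft threshold \<open>v \<mapsto> (1 - s / norm v) *\<^sub>R v\<close>
  is nonexpansive outside the ball of radius \<open>s\<close> in every normed space, although the radial
  projection onto that ball need not be.
\<close>

lemma flatten_lipschitz:
  fixes v w :: "'a::real_normed_vector"
  assumes "\<delta> \<ge> 0" "s > 0" "s < norm w" "norm w \<le> norm v"
  defines "\<phi> \<equiv> flatten_factor \<delta> s"
  shows "norm (\<phi> (norm v) *\<^sub>R v - \<phi> (norm w) *\<^sub>R w) \<le> (1 + \<delta>) * norm (v - w)"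
proof -
  let ?a = "norm v" and ?b = "norm w"
  have b: "0 < ?b" "0 < ?a" using assms by linarith+
  have mono: "(1 + \<delta>) * (1 - s / ?b) \<le> (1 + \<delta>) * (1 - s / ?a)"
    using assms b by (intro mult_left_mono) (auto intro!: divide_left_mono)
  have eqb: "\<phi> ?b = min 1 ((1 + \<delta>) * (1 - s / ?b))" and eqa: "\<phi> ?a = min 1 ((1 + \<delta>) * (1 - s / ?a))"
    using assms by (auto simp: flatten_factor_def)
  have le: "\<phi> ?b \<le> \<phi> ?a" using mono eqa eqb by auto
  have n0: "0 \<le> \<phi> ?b" using flatten_factor_bounds assms by auto
  \<comment> \<open>The difference of the factors goes with the longer vector: its norm turns
    \<open>s / ?b - s / ?a\<close> into \<open>(s / ?b) * (?a - ?b)\<close>, and the coefficients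
    \<open>1 - s / ?b\<close> and \<open>s / ?b\<close> then add up to 1.\<close>
  have "\<phi> ?a *\<^sub>R v - \<phi> ?b *\<^sub>R w = \<phi> ?b *\<^sub>R (v - w) + (\<phi> ?a - \<phi> ?b) *\<^sub>R v"
    by (simp add: algebra_simps)
  then have 1: "norm (\<phi> ?a *\<^sub>R v - \<phi> ?b *\<^sub>R w) \<le> \<phi> ?b * norm (v - w) + (\<phi> ?a - \<phi> ?b) * ?a"
    using norm_triangle_ineq[of "\<phi> ?b *\<^sub>R (v - w)" "(\<phi> ?a - \<phi> ?b) *\<^sub>R v"] le n0 by simp
  show ?thesis
  proof (cases "1 \<le> (1 + \<delta>) * (1 - s / ?b)")
    case True
    then have "\<phi> ?a = 1" "\<phi> ?b = 1" using mono eqa eqb by auto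
    then show ?thesis using 1 assms(1) mult_right_mono[of 1 "1 + \<delta>" "norm (v - w)"] by simp
  next
    case False
    have "(\<phi> ?a - \<phi> ?b) * ?a \<le> ((1 + \<delta>) * (1 - s / ?a) - (1 + \<delta>) * (1 - s / ?b)) * ?a"
      using False eqa eqb b by (intro mult_right_mono) auto
    also have "\<dots> = (1 + \<delta>) * (s / ?b) * (?a - ?b)" using b by (simp add: field_simps)
    also have "\<dots> \<le> (1 + \<delta>) * (s / ?b) * norm (v - w)"
      using assms b norm_triangle_ineq2[of v w] by (intro mult_left_mono) auto
    finally have "(\<phi> ?a - \<phi> ?b) * ?a \<le> (1 + \<delta>) * (s / ?b) * norm (v - w)" .
    moreover have "\<phi> ?b * norm (v - w) = (1 + \<delta>) * (1 - s / ?b) * norm (v - w)"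
      using False eqb by simp
    ultimately show ?thesis using 1 by (simp add: algebra_simps)
  qed
qed

text \<open>
  Near \<open>p\<close> the map \<open>F\<close> is made constant on the ball of radius \<open>s\<close>, at the cost of a factor
  \<open>1 + \<delta>\<close> in the Lipschitz constant, and a cone of slope one in the direction \<open>u\<close> is put there.
\<close>

definition bump :: "real \<Rightarrow> real \<Rightarrow> ('a::real_normed_vector \<Rightarrow> 'a) \<Rightarrow> 'a \<Rightarrow> 'a \<Rightarrow> 'a \<Rightarrow> 'a" where
  "bump \<delta> s F p u x =
     F (p + flatten_factor \<delta> s (norm (x - p)) *\<^sub>R (x - p)) + max 0 (s - norm (x - p)) *\<^sub>R u"

lemma flatten_in_convex:
  assumes "convex C" "p \<in> C" "x \<in> C" "\<delta> \<ge> 0" "s > 0"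
  shows "p + flatten_factor \<delta> s t *\<^sub>R (x - p) \<in> C"
proof -
  have "p + flatten_factor \<delta> s t *\<^sub>R (x - p)
      = (1 - flatten_factor \<delta> s t) *\<^sub>R p + flatten_factor \<delta> s t *\<^sub>R x"
    by (simp add: algebra_simps)
  then show ?thesis
    using convexD_alt[OF assms(1-3) flatten_factor_bounds[OF assms(4,5), of t]] by simp
qed

lemma bump_eq:
  assumes "\<delta> > 0" "s > 0" "(1 + \<delta>) * s / \<delta> \<le> norm (x - p)"
  shows "bump \<delta> s F p u x = F x"
proof -
  have "s \<le> (1 + \<delta>) * s / \<delta>" using assms by (simp add: field_simps)
  then show ?thesis using flatten_factor_eq_1[OF assms] assms by (simp add: bump_def)
qed

text \<open>The contraction \<open>1 - \<delta>\<close> absorbs the stretch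
  \<open>1 + \<delta>\<close>, as their product is at most 1. The cone lives where the flattened map
  is constant. For points on either side of the sphere of radius \<open>s\<close>, the cone
  contributes \<open>s - norm (x - p)\<close> and the outer part at most
  \<open>norm (y - p) - s\<close>; the sum is at most \<open>norm (y - x)\<close>.\<close>

lemma bump_nonexpansive:
  fixes F :: "'a::real_normed_vector \<Rightarrow> 'a"
  assumes "convex C" "0 < \<delta>" "\<delta> \<le> 1" "s > 0" "p \<in> C" "norm u = 1"
    and F: "\<And>x y. x \<in> C \<Longrightarrow> y \<in> C \<Longrightarrow> norm (F y - F x) \<le> (1 - \<delta>) * norm (y - x)"
    and xy: "x \<in> C" "y \<in> C"
  shows "norm (bump \<delta> s F p u y - bump \<delta> s F p u x) \<le> norm (y - x)"
proof -
  let ?\<phi> = "flatten_factor \<delta> s"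
  have shrink: "(1 - \<delta>) * ((1 + \<delta>) * a) \<le> a" if "a \<ge> 0" for a
  proof -
    have "(1 - \<delta>) * ((1 + \<delta>) * a) = a - \<delta>\<^sup>2 * a" by (simp add: algebra_simps power2_eq_square)
    then show ?thesis using that by simp
  qed
  have main: "norm (bump \<delta> s F p u y - bump \<delta> s F p u x) \<le> norm (y - x)"
    if xy: "x \<in> C" "y \<in> C" and le: "norm (x - p) \<le> norm (y - p)" for x y
  proof -
    let ?v = "y - p" and ?w = "x - p"
    have tri: "norm ?v - norm ?w \<le> norm (y - x)"
      using norm_triangle_ineq2[of ?v ?w] by simp
    have inC: "p + ?\<phi> (norm ?v) *\<^sub>R ?v \<in> C" "p + ?\<phi> (norm ?w) *\<^sub>R ?w \<in> C"
      using flatten_in_convex assms xy by (metis less_imp_le)+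
    consider "norm ?v \<le> s" | "norm ?w \<le> s" "s < norm ?v" | "s < norm ?w" by linarith
    then show ?thesis
    proof cases
      case 1
      then have "bump \<delta> s F p u y - bump \<delta> s F p u x = (norm ?w - norm ?v) *\<^sub>R u"
        using le by (simp add: bump_def flatten_factor_def max_def scaleR_left_diff_distrib)
      then show ?thesis using le tri \<open>norm u = 1\<close> by simp
    next
      case 2
      then have "bump \<delta> s F p u y - bump \<delta> s F p u x
          = (F (p + ?\<phi> (norm ?v) *\<^sub>R ?v) - F p) - (s - norm ?w) *\<^sub>R u"
        by (simp add: bump_def flatten_factor_def)
      then have "norm (bump \<delta> s F p u y - bump \<delta> s F p u x)
          \<le> norm (F (p + ?\<phi> (norm ?v) *\<^sub>R ?v) - F p) + (s - norm ?w)"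
        using norm_triangle_ineq4[of "F (p + ?\<phi> (norm ?v) *\<^sub>R ?v) - F p" "(s - norm ?w) *\<^sub>R u"]
          2 \<open>norm u = 1\<close> by simp
      also have "norm (F (p + ?\<phi> (norm ?v) *\<^sub>R ?v) - F p) \<le> (1 - \<delta>) * (?\<phi> (norm ?v) * norm ?v)"
        using F[OF \<open>p \<in> C\<close> inC(1)] flatten_factor_bounds(1)[of \<delta> s "norm ?v"] assms by simp
      also have "\<dots> \<le> (1 - \<delta>) * ((1 + \<delta>) * (norm ?v - s))"
        using flatten_factor_times_le[of \<delta> s "norm ?v"] 2 assms by (intro mult_left_mono) auto
      also have "\<dots> \<le> norm ?v - s" using shrink 2 by simp
      finally show ?thesis using tri by simp
    next
      case 3
      then have "bump \<delta> s F p u y - bump \<delta> s F p u x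
          = F (p + ?\<phi> (norm ?v) *\<^sub>R ?v) - F (p + ?\<phi> (norm ?w) *\<^sub>R ?w)"
        using le by (simp add: bump_def)
      also have "norm \<dots> \<le> (1 - \<delta>) * norm (?\<phi> (norm ?v) *\<^sub>R ?v - ?\<phi> (norm ?w) *\<^sub>R ?w)"
        using F[OF inC(2,1)] by simp
      also have "\<dots> \<le> (1 - \<delta>) * ((1 + \<delta>) * norm (?v - ?w))"
        using flatten_lipschitz[of \<delta> s ?w ?v] 3 le assms by (intro mult_left_mono) auto
      also have "\<dots> \<le> norm (y - x)" using shrink[of "norm (y - x)"] by simp
      finally show ?thesis .
    qed
  qed
  show ?thesis
    using main[OF xy] main[OF xy(2,1)] by (metis linear norm_minus_commute)
qed

text \<open>Inside the ball of radius \<open>s\<close> the values run along the segment from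
  \<open>F p\<close> to \<open>F p + s *\<^sub>R u\<close>; outside they are values of
  \<open>F\<close> at points of \<open>C\<close>.\<close>

lemma bump_in_convex:
  fixes F :: "'a::real_normed_vector \<Rightarrow> 'a"
  assumes "convex C" "0 < \<delta>" "s > 0" "p \<in> C" "x \<in> C"
    and F: "\<And>x. x \<in> C \<Longrightarrow> F x \<in> C" and u: "F p + s *\<^sub>R u \<in> C"
  shows "bump \<delta> s F p u x \<in> C"
proof (cases "norm (x - p) \<le> s")
  case True
  define a where "a = (s - norm (x - p)) / s"
  have a: "0 \<le> a" "a \<le> 1" using True assms by (auto simp: a_def)
  have "a * s = s - norm (x - p)" using \<open>s > 0\<close> by (simp add: a_def)
  then have "bump \<delta> s F p u x = F p + (a * s) *\<^sub>R u"
    using True by (simp add: bump_def flatten_factor_def)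
  then have "bump \<delta> s F p u x = (1 - a) *\<^sub>R F p + a *\<^sub>R (F p + s *\<^sub>R u)"
    by (simp add: algebra_simps)
  then show ?thesis using convexD_alt[OF \<open>convex C\<close> F[OF \<open>p \<in> C\<close>] u a] by simp
next
  case False
  then show ?thesis using F flatten_in_convex[of C p x \<delta> s] assms by (simp add: bump_def)
qed

text \<open>Inside the ball, replacing \<open>x\<close> by \<open>p\<close> costs at most
  \<open>norm (x - p)\<close>, and the cone adds \<open>s - norm (x - p)\<close>. Outside,
  flattening moves the argument by at most \<open>s\<close>.\<close>

lemma bump_displacement:
  fixes F :: "'a::real_normed_vector \<Rightarrow> 'a"
  assumes "convex C" "0 < \<delta>" "s > 0" "p \<in> C" "norm u = 1" "x \<in> C"
    and F: "\<And>x y. x \<in> C \<Longrightarrow> y \<in> C \<Longrightarrow> norm (F y - F x) \<le> norm (y - x)"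
  shows "norm (bump \<delta> s F p u x - F x) \<le> 2 * s"
proof (cases "norm (x - p) \<le> s")
  case True
  then have "bump \<delta> s F p u x - F x = (F p - F x) + (s - norm (x - p)) *\<^sub>R u"
    by (simp add: bump_def flatten_factor_def)
  also have "norm \<dots> \<le> norm (F p - F x) + (s - norm (x - p))"
    using norm_triangle_ineq[of "F p - F x" "(s - norm (x - p)) *\<^sub>R u"] True assms(5) by simp
  finally have "norm (bump \<delta> s F p u x - F x) \<le> norm (F p - F x) + (s - norm (x - p))" .
  moreover have "norm (F p - F x) \<le> norm (x - p)"
    using F[of x p] assms by (simp add: norm_minus_commute)
  ultimately show ?thesis using \<open>s > 0\<close> by simp
next
  case False
  let ?a = "flatten_factor \<delta> s (norm (x - p))"
  have "norm (bump \<delta> s F p u x - F x) \<le> norm (p + ?a *\<^sub>R (x - p) - x)"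
    using False F[of x "p + ?a *\<^sub>R (x - p)"] flatten_in_convex[of C p x \<delta> s] assms
    by (simp add: bump_def)
  also have "p + ?a *\<^sub>R (x - p) - x = - ((1 - ?a) *\<^sub>R (x - p))"
    by (simp add: algebra_simps)
  also have "norm \<dots> = (1 - ?a) * norm (x - p)"
    using flatten_factor_bounds(2)[of \<delta> s] assms by simp
  also have "\<dots> \<le> s" using flatten_factor_displacement[of \<delta> s] False assms by simp
  finally show ?thesis using \<open>s > 0\<close> by simp
qed

section \<open>Perturbing to slope one in every ball\<close>

text \<open>The ratio \<open>s / r\<close> does not depend on \<open>f\<close>, as porosity demands.
  The factor \<open>1 / 8\<close> keeps the displacement \<open>2 * s\<close> of the bumps within
  \<open>r / 4\<close>; the factor with \<open>\<rho>\<close> keeps each bump within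
  \<open>\<rho> / 8\<close> of its centre.\<close>

lemma uniform_slope_one_perturbation:
  fixes C :: "'a::real_normed_vector set" and f :: "'a \<Rightarrow> 'a"
  assumes "convex C" "C \<noteq> {}" "D > 0" "e > 0" "\<rho> > 0" "0 < r" "r \<le> e"
    and D: "\<And>x y. x \<in> C \<Longrightarrow> y \<in> C \<Longrightarrow> norm (y - x) \<le> D"
    and far: "\<And>x. x \<in> C \<Longrightarrow> \<exists>q\<in>C. e \<le> norm (q - x)"
    and fC: "\<And>x. x \<in> C \<Longrightarrow> f x \<in> C"
    and f: "\<And>x y. x \<in> C \<Longrightarrow> y \<in> C \<Longrightarrow> norm (f y - f x) \<le> norm (y - x)"
  defines "s \<equiv> min (1 / 8) (\<rho> / (64 * D)) * r"
  obtains g where "\<And>x. x \<in> C \<Longrightarrow> g x \<in> C"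
    and "\<And>x y. x \<in> C \<Longrightarrow> y \<in> C \<Longrightarrow> norm (g y - g x) \<le> norm (y - x)"
    and "\<And>x. x \<in> C \<Longrightarrow> norm (g x - f x) \<le> r / 2"
    and "\<And>z. z \<in> C \<Longrightarrow> \<exists>x\<in>C \<inter> ball z \<rho>. \<exists>y\<in>C \<inter> ball z \<rho>. norm (y - x) = s \<and> norm (g y - g x) = s"
proof -
  obtain c where c: "c \<in> C" using \<open>C \<noteq> {}\<close> by blast
  obtain q0 where "q0 \<in> C" "e \<le> norm (q0 - c)" using far c by blast
  then have "r \<le> D" using D[OF c] \<open>r \<le> e\<close> by force
  \<comment> \<open>With this choice the contraction towards \<open>c\<close> moves \<open>f\<close>
    by at most \<open>\<delta> * D = r / 4\<close>.\<close>
  define \<delta> where "\<delta> = r / (4 * D)"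
  have \<delta>: "0 < \<delta>" "\<delta> \<le> 1 / 4" using \<open>r \<le> D\<close> \<open>D > 0\<close> \<open>r > 0\<close> by (auto simp: \<delta>_def field_simps)
  have s0: "0 < s" using \<open>D > 0\<close> \<open>r > 0\<close> \<open>\<rho> > 0\<close> by (simp add: s_def)
  have s8: "s \<le> r / 8"
    using mult_right_mono[of "min (1 / 8) (\<rho> / (64 * D))" "1 / 8" r] \<open>r > 0\<close> by (simp add: s_def)
  have s\<rho>: "s \<le> \<rho> / (64 * D) * r"
    using mult_right_mono[of "min (1 / 8) (\<rho> / (64 * D))" "\<rho> / (64 * D)" r] \<open>r > 0\<close> by (simp add: s_def)
  \<comment> \<open>From distance \<open>T\<close> on, a bump agrees with \<open>F\<close>.\<close>
  define T where "T = (1 + \<delta>) * s / \<delta>"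
  have "T \<le> 2 * s / \<delta>"
    unfolding T_def using \<delta> s0 by (intro divide_right_mono mult_right_mono) auto
  also have "\<dots> = 8 * D * s / r" using \<open>D > 0\<close> \<open>r > 0\<close> by (simp add: \<delta>_def)
  also have "\<dots> \<le> \<rho> / 8" using s\<rho> \<open>D > 0\<close> \<open>r > 0\<close> by (simp add: field_simps)
  finally have T\<rho>: "T \<le> \<rho> / 8" .
  have sT: "s < T" using \<delta> s0 by (simp add: T_def field_simps)
  obtain \<Gamma> where \<Gamma>C: "\<Gamma> \<subseteq> C"
    and sep: "\<And>p q. p \<in> \<Gamma> \<Longrightarrow> q \<in> \<Gamma> \<Longrightarrow> p \<noteq> q \<Longrightarrow> \<rho> / 2 \<le> dist p q"
    and net: "\<And>x. x \<in> C \<Longrightarrow> \<exists>p\<in>\<Gamma>. dist x p < \<rho> / 2"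
    using maximal_separated_set[of "\<rho> / 2" C] \<open>\<rho> > 0\<close> by auto
  define F where "F x = (1 - \<delta>) *\<^sub>R f x + \<delta> *\<^sub>R c" for x
  have FC: "F x \<in> C" if "x \<in> C" for x
    using convexD_alt[OF \<open>convex C\<close> fC[OF that] c, of \<delta>] \<delta> by (simp add: F_def)
  have F: "norm (F y - F x) \<le> (1 - \<delta>) * norm (y - x)" if "x \<in> C" "y \<in> C" for x y
  proof -
    have "F y - F x = (1 - \<delta>) *\<^sub>R (f y - f x)" by (simp add: F_def algebra_simps)
    then show ?thesis using mult_left_mono[OF f[OF that], of "1 - \<delta>"] \<delta> by simp
  qed
  have F1: "norm (F y - F x) \<le> norm (y - x)" if "x \<in> C" "y \<in> C" for x y
    using F[OF that] mult_right_mono[of "1 - \<delta>" 1 "norm (y - x)"] \<delta> by simp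
  have Ff: "norm (F x - f x) \<le> r / 4" if "x \<in> C" for x
  proof -
    have "F x - f x = \<delta> *\<^sub>R (c - f x)" by (simp add: F_def algebra_simps)
    then have "norm (F x - f x) \<le> \<delta> * D"
      using mult_left_mono[OF D[OF fC[OF that] c], of \<delta>] \<delta> by simp
    then show ?thesis using \<open>D > 0\<close> by (simp add: \<delta>_def)
  qed
  \<comment> \<open>Some point of \<open>C\<close> is at distance at least \<open>e \<ge> s\<close>
    from \<open>F p\<close>; the direction towards it stays in \<open>C\<close> for length
    \<open>s\<close>.\<close>
  have "\<exists>q. norm q = 1 \<and> F p + s *\<^sub>R q \<in> C" if p: "p \<in> C" for p
  proof -
    obtain q where q: "q \<in> C" "e \<le> norm (q - F p)" using far FC[OF p] by blast
    let ?n = "norm (q - F p)"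
    have n: "s \<le> ?n" "?n > 0" using q s8 \<open>r \<le> e\<close> \<open>e > 0\<close> \<open>r > 0\<close> by auto
    have "F p + s *\<^sub>R ((q - F p) /\<^sub>R ?n) = (1 - s / ?n) *\<^sub>R F p + (s / ?n) *\<^sub>R q"
      by (simp add: algebra_simps divide_inverse)
    then have "F p + s *\<^sub>R ((q - F p) /\<^sub>R ?n) \<in> C"
      using convexD_alt[OF \<open>convex C\<close> FC[OF p] q(1), of "s / ?n"] n s0 by simp
    then show ?thesis using n by (intro exI[of _ "(q - F p) /\<^sub>R ?n"]) simp
  qed
  then obtain u where u: "\<And>p. p \<in> C \<Longrightarrow> norm (u p) = 1" "\<And>p. p \<in> C \<Longrightarrow> F p + s *\<^sub>R u p \<in> C"
    by metis
  define G where "G p = bump \<delta> s F p (u p)" for p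
  have GF: "G p x = F x" if "T \<le> norm (x - p)" for p x
    using bump_eq \<delta>(1) s0 that unfolding G_def T_def by blast
  define centre where "centre x = (SOME p. p \<in> \<Gamma> \<and> norm (x - p) < T)" for x
  define g where "g x = (if \<exists>p\<in>\<Gamma>. norm (x - p) < T then G (centre x) x else F x)" for x
  \<comment> \<open>The chain \<open>p\<close>, \<open>x\<close>, \<open>y\<close>, \<open>q\<close>
    is shorter than \<open>3 * \<rho> / 8\<close>, below the separation \<open>\<rho> / 2\<close>.
    The case \<open>y = x\<close> shows that \<open>centre\<close> is well determined.\<close>
  have unique: "p = q"
    if "p \<in> \<Gamma>" "q \<in> \<Gamma>" "norm (x - p) < T" "norm (y - q) < T" "norm (y - x) < \<rho> / 8" for p q x y
  proof (rule ccontr)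
    assume "p \<noteq> q"
    then have "\<rho> / 2 \<le> norm (p - q)" using sep that by (simp add: dist_norm)
    moreover have "norm (p - q) \<le> norm (x - p) + norm (y - q) + norm (y - x)"
      using norm_triangle_ineq4[of "y - q" "(y - x) + (x - p)"] norm_triangle_ineq[of "y - x" "x - p"]
      by (simp add: algebra_simps)
    ultimately show False using that T\<rho> \<open>\<rho> > 0\<close> by linarith
  qed
  have gG: "g x = G p x" if "p \<in> \<Gamma>" "norm (x - p) < T" for x p
  proof -
    have "centre x \<in> \<Gamma> \<and> norm (x - centre x) < T"
      unfolding centre_def by (rule someI[of _ p]) (use that in simp)
    then have "centre x = p" using unique[of "centre x" p x x] that \<open>\<rho> > 0\<close> by simp
    then show ?thesis using that by (auto simp: g_def)
  qed
  \<comment> \<open>Nearby points see a common bump, so the estimates for one bump carry over to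
    \<open>g\<close>.\<close>
  have local: "\<exists>p\<in>\<Gamma>. g x = G p x \<and> g y = G p y" if "x \<in> C" "y \<in> C" "norm (y - x) < \<rho> / 8" for x y
  proof -
    have one: "\<exists>p\<in>\<Gamma>. g x = G p x \<and> g y = G p y"
      if "p \<in> \<Gamma>" "norm (x - p) < T" "norm (y - x) < \<rho> / 8" for p x y
    proof (cases "\<exists>q\<in>\<Gamma>. norm (y - q) < T")
      case True
      then show ?thesis using unique that gG by metis
    next
      case False
      then have "g y = F y" "T \<le> norm (y - p)" using that by (auto simp: g_def)
      then show ?thesis using GF gG that by metis
    qed
    \<comment> \<open>Far from all centres every \<open>G p\<close> equals \<open>F\<close>, so any
      element of \<open>\<Gamma>\<close> serves for a pair of such points.\<close>
    obtain p0 where p0: "p0 \<in> \<Gamma>" using net c by blast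
    consider "\<exists>p\<in>\<Gamma>. norm (x - p) < T" | "\<exists>p\<in>\<Gamma>. norm (y - p) < T"
      | "\<not> (\<exists>p\<in>\<Gamma>. norm (x - p) < T)" "\<not> (\<exists>p\<in>\<Gamma>. norm (y - p) < T)" by blast
    then show ?thesis
    proof cases
      case 1
      then show ?thesis using one that by blast
    next
      case 2
      then show ?thesis using one[of _ y x] that by (metis norm_minus_commute)
    next
      case 3
      then have "g x = F x" "g y = F y" by (auto simp: g_def)
      moreover have "G p0 x = F x" "G p0 y = F y" using 3 p0 GF by (meson not_less)+
      ultimately show ?thesis using p0 by metis
    qed
  qed
  show thesis
  proof
    fix x assume x: "x \<in> C"
    obtain p where p: "p \<in> \<Gamma>" "g x = G p x" using local[OF x x] \<open>\<rho> > 0\<close> by auto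
    have pC: "p \<in> C" using p \<Gamma>C by blast
    show "g x \<in> C"
      unfolding p(2) G_def by (rule bump_in_convex[OF assms(1) \<delta>(1) s0 pC x]) (use FC u(2)[OF pC] in auto)
    have "norm (G p x - F x) \<le> 2 * s"
      unfolding G_def by (rule bump_displacement[OF assms(1) \<delta>(1) s0 pC u(1)[OF pC] x F1])
    moreover have "norm (g x - f x) \<le> norm (G p x - F x) + norm (F x - f x)"
      using norm_triangle_ineq[of "G p x - F x" "F x - f x"] p by simp
    ultimately show "norm (g x - f x) \<le> r / 2" using Ff[OF x] s8 by linarith
  next
    fix x y assume xy: "x \<in> C" "y \<in> C"
    have "norm (g y - g x) \<le> 1 * norm (y - x)"
    proof (rule convex_lipschitz_local_to_global[OF assms(1) _ _ xy, of "\<rho> / 8"])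
      fix x y assume xy: "x \<in> C" "y \<in> C" "norm (y - x) < \<rho> / 8"
      obtain p where p: "p \<in> \<Gamma>" "g x = G p x" "g y = G p y" using local[OF xy] by blast
      have pC: "p \<in> C" using p \<Gamma>C by blast
      show "norm (g y - g x) \<le> 1 * norm (y - x)"
        using bump_nonexpansive[OF assms(1) \<delta>(1) _ s0 pC u(1)[OF pC] F xy(1,2)] \<delta>(2) p
        by (simp add: G_def)
    qed (use \<open>\<rho> > 0\<close> in auto)
    then show "norm (g y - g x) \<le> norm (y - x)" by simp
  next
    fix z assume "z \<in> C"
    then obtain p where p: "p \<in> \<Gamma>" "dist z p < \<rho> / 2" using net by blast
    have pC: "p \<in> C" using p \<Gamma>C by blast
    obtain q where q: "q \<in> C" "e \<le> norm (q - p)" using far pC by blast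
    let ?n = "norm (q - p)"
    have n: "s \<le> ?n" "?n > 0" using q s8 \<open>r \<le> e\<close> \<open>e > 0\<close> \<open>r > 0\<close> by auto
    \<comment> \<open>The pair of slope one is the tip \<open>p\<close> of a cone and a point
      \<open>y\<close> on its rim: the flattened part takes the value \<open>F p\<close> at both,
      while the cone drops from height \<open>s\<close> to 0.\<close>
    define y where "y = p + (s / ?n) *\<^sub>R (q - p)"
    have "y = (1 - s / ?n) *\<^sub>R p + (s / ?n) *\<^sub>R q" by (simp add: y_def algebra_simps)
    then have yC: "y \<in> C" using convexD_alt[OF assms(1) pC q(1), of "s / ?n"] n s0 by simp
    have yp: "norm (y - p) = s" using n s0 by (simp add: y_def)
    have "dist z y \<le> dist z p + s" using dist_triangle[of z y p] yp by (simp add: dist_norm norm_minus_commute)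
    then have yz: "y \<in> ball z \<rho>" using p(2) sT T\<rho> \<open>\<rho> > 0\<close> by simp
    have "g p = G p p" using gG p(1) s0 sT by simp
    also have "G p p = F p + s *\<^sub>R u p" using s0 by (simp add: G_def bump_def)
    finally have gp: "g p = F p + s *\<^sub>R u p" .
    have "g y = G p y" using gG p(1) yp sT by simp
    also have "G p y = F p" using yp by (simp add: G_def bump_def flatten_factor_def)
    finally have "norm (g y - g p) = s" using gp u(1)[OF pC] s0 by simp
    then show "\<exists>x\<in>C \<inter> ball z \<rho>. \<exists>y\<in>C \<inter> ball z \<rho>. norm (y - x) = s \<and> norm (g y - g x) = s"
      using pC yC yp yz p(2) \<open>\<rho> > 0\<close> by (intro bexI[of _ p] bexI[of _ y]) auto
  qed
qed

section \<open>Lower porosity of the locally contracting maps\<close>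

definition locally_contracting :: "'a::real_normed_vector set \<Rightarrow> real \<Rightarrow> real \<Rightarrow> ('a \<Rightarrow> 'a) set" where
  "locally_contracting C \<beta> \<rho> = {f \<in> mspace (nonexpansive_space C).
     \<exists>z\<in>C. \<forall>x\<in>C \<inter> ball z \<rho>. \<forall>y\<in>C \<inter> ball z \<rho>. norm (f y - f x) \<le> \<beta> * norm (y - x)}"

text \<open>The supremum is a real one, so it dominates its members only once the family is bounded
  above; \<open>bounded C\<close> provides this.\<close>

lemma norm_diff_le_mdist_nonexpansive_space:
  fixes C :: "'a::real_normed_vector set"
  assumes "bounded C" "f \<in> mspace (nonexpansive_space C)" "g \<in> mspace (nonexpansive_space C)" "x \<in> C"
  shows "norm (g x - f x) \<le> mdist (nonexpansive_space C) f g"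
proof -
  obtain B where B: "\<And>x. x \<in> C \<Longrightarrow> norm x \<le> B" using \<open>bounded C\<close> by (auto simp: bounded_iff)
  have "norm (g z - f z) \<le> B + B" if "z \<in> C" for z
    using assms that B[of "f z"] B[of "g z"] norm_triangle_ineq4[of "g z" "f z"]
    by (force simp: mspace_nonexpansive_space PiE_def Pi_def)
  then have "bdd_above ((\<lambda>x. norm (g x - f x)) ` C)" by (intro bdd_aboveI2)
  then show ?thesis
    using assms by (subst mdist_nonexpansive_space) (auto intro: cSUP_upper)
qed

lemma porosity_radius_mono:
  assumes "r \<le> r'"
  shows "porosity_radius m x r P \<le> porosity_radius m x r' P"
proof -
  have "mball_of m x r \<subseteq> mball_of m x r'" using assms by auto
  then show ?thesis unfolding porosity_radius_def by (intro Sup_subset_mono) blast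
qed

text \<open>A linear lower bound for small radii bounds the lower limit by \<open>c\<close>; larger
  radii reduce to \<open>e\<close> by monotonicity.\<close>

lemma lower_porous_atI:
  assumes "0 < c" "0 < e" and c: "\<And>r. 0 < r \<Longrightarrow> r \<le> e \<Longrightarrow> ereal (c * r) \<le> porosity_radius m x r P"
  shows "lower_porous_at m P x"
  unfolding lower_porous_at_def
proof (intro conjI allI impI)
  fix r :: real assume "r > 0"
  then have "0 < ereal (c * min r e)" using assms by simp
  also have "\<dots> \<le> porosity_radius m x (min r e) P" using c \<open>r > 0\<close> \<open>0 < e\<close> by simp
  also have "\<dots> \<le> porosity_radius m x r P" by (intro porosity_radius_mono) simp
  finally show "porosity_radius m x r P > 0" .
next
  have "ereal c \<le> Liminf (at_right 0) (\<lambda>r. porosity_radius m x r P / ereal r)"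
  proof (rule Liminf_bounded)
    have "ereal c \<le> porosity_radius m x r P / ereal r" if "0 < r" "r < e" for r
      using c[of r] that by (simp add: ereal_le_divide_pos mult.commute)
    then show "\<forall>\<^sub>F r in at_right 0. ereal c \<le> porosity_radius m x r P / ereal r"
      by (intro eventually_mono[OF eventually_at_right_real[OF \<open>0 < e\<close>]]) auto
  qed
  then show "0 < Liminf (at_right 0) (\<lambda>r. porosity_radius m x r P / ereal r)"
    using \<open>0 < c\<close> by (metis ereal_less(2) less_le_trans)
qed

lemma lower_porous_locally_contracting:
  fixes C :: "'a::real_normed_vector set"
  assumes "bounded C" "convex C" "C \<noteq> {}" "\<not> is_singleton C" "0 \<le> \<beta>" "\<beta> < 1" "\<rho> > 0"
  shows "lower_porous (nonexpansive_space C) (locally_contracting C \<beta> \<rho>)"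
proof -
  let ?M = "nonexpansive_space C" and ?P = "locally_contracting C \<beta> \<rho>"
  obtain a b where ab: "a \<in> C" "b \<in> C" "a \<noteq> b"
    using assms(3,4) by (metis all_not_in_conv is_singletonI')
  \<comment> \<open>No point is closer than half the distance of \<open>a\<close> and
    \<open>b\<close> to both of them.\<close>
  define e where "e = norm (a - b) / 2"
  have e: "e > 0" using ab by (simp add: e_def)
  have far: "\<exists>q\<in>C. e \<le> norm (q - x)" if "x \<in> C" for x
  proof (rule ccontr)
    assume "\<not> ?thesis"
    then have "norm (a - x) < e" "norm (b - x) < e" using ab by auto
    then show False using norm_triangle_ineq4[of "a - x" "b - x"] by (simp add: e_def)
  qed
  obtain B where B: "B > 0" "\<And>x. x \<in> C \<Longrightarrow> norm x \<le> B" using \<open>bounded C\<close> by (auto simp: bounded_pos)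
  define D where "D = B + B"
  have "D > 0" using B by (simp add: D_def)
  have D: "norm (y - x) \<le> D" if "x \<in> C" "y \<in> C" for x y
    using B(1) B(2)[OF that(1)] B(2)[OF that(2)] norm_triangle_ineq4[of y x] by (auto simp: D_def)
  define \<kappa> where "\<kappa> = min (1 / 8) (\<rho> / (64 * D))"
  \<comment> \<open>A map closer than \<open>c * \<kappa> * r\<close> to \<open>g\<close> loses less
    than \<open>2 * c * \<kappa> * r = (1 - \<beta>) * \<kappa> * r\<close> of an increment
    \<open>\<kappa> * r\<close>, so its slope there stays above \<open>\<beta>\<close>.\<close>
  define c where "c = (1 - \<beta>) / 2"
  have \<kappa>: "0 < \<kappa>" "\<kappa> \<le> 1 / 8" using \<open>D > 0\<close> \<open>\<rho> > 0\<close> by (auto simp: \<kappa>_def)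
  have c: "0 < c" "c \<le> 1 / 2" using assms by (auto simp: c_def)
  have "ereal (c * \<kappa> * r) \<le> porosity_radius ?M f r ?P"
    if f: "f \<in> mspace ?M" and r: "0 < r" "r \<le> e" for f r
  proof -
    have f': "\<And>x. x \<in> C \<Longrightarrow> f x \<in> C"
      "\<And>x y. x \<in> C \<Longrightarrow> y \<in> C \<Longrightarrow> norm (f y - f x) \<le> norm (y - x)"
      using f \<open>bounded C\<close> by (auto simp: mspace_nonexpansive_space)
    obtain g0 where g0: "\<And>x. x \<in> C \<Longrightarrow> g0 x \<in> C"
      "\<And>x y. x \<in> C \<Longrightarrow> y \<in> C \<Longrightarrow> norm (g0 y - g0 x) \<le> norm (y - x)"
      "\<And>x. x \<in> C \<Longrightarrow> norm (g0 x - f x) \<le> r / 2"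
      "\<And>z. z \<in> C \<Longrightarrow> \<exists>x\<in>C \<inter> ball z \<rho>. \<exists>y\<in>C \<inter> ball z \<rho>.
         norm (y - x) = \<kappa> * r \<and> norm (g0 y - g0 x) = \<kappa> * r"
      by (rule uniform_slope_one_perturbation[OF \<open>convex C\<close> \<open>C \<noteq> {}\<close> \<open>D > 0\<close> e \<open>\<rho> > 0\<close> r D far f',
            folded \<kappa>_def]) (assumption | rule that | simp)+
    \<comment> \<open>Members of the space are extensional on \<open>C\<close>.\<close>
    define g where "g = restrict g0 C"
    have gM: "g \<in> mspace ?M"
      using g0 \<open>bounded C\<close> by (auto simp: mspace_nonexpansive_space g_def)
    have fg: "mdist ?M f g \<le> r / 2"
      unfolding mdist_nonexpansive_space[OF \<open>C \<noteq> {}\<close> f gM]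
      using g0(3) \<open>C \<noteq> {}\<close> by (intro cSUP_least) (auto simp: g_def)
    have small: "c * \<kappa> * r \<le> r / 16"
    proof -
      have "c * \<kappa> \<le> 1 / 2 * (1 / 8)" using c \<kappa> by (intro mult_mono) auto
      then show ?thesis using mult_right_mono[of "c * \<kappa>" "1 / 16" r] r by simp
    qed
    have "mball_of ?M g (c * \<kappa> * r) \<subseteq> mball_of ?M f r - ?P"
    proof
      fix h assume "h \<in> mball_of ?M g (c * \<kappa> * r)"
      then have h: "h \<in> mspace ?M" "mdist ?M g h < c * \<kappa> * r" by auto
      have "mdist ?M f h < r"
        using mdist_triangle[OF f gM h(1)] fg h(2) small r by linarith
      moreover have "h \<notin> ?P"
      proof
        assume "h \<in> ?P"
        then obtain z where z: "z \<in> C"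
          "\<And>x y. x \<in> C \<inter> ball z \<rho> \<Longrightarrow> y \<in> C \<inter> ball z \<rho> \<Longrightarrow> norm (h y - h x) \<le> \<beta> * norm (y - x)"
          unfolding locally_contracting_def by blast
        obtain x y where xy: "x \<in> C \<inter> ball z \<rho>" "y \<in> C \<inter> ball z \<rho>"
          "norm (y - x) = \<kappa> * r" "norm (g0 y - g0 x) = \<kappa> * r"
          using g0(4)[OF z(1)] by blast
        have "norm (g y - g x) = \<kappa> * r" using xy by (simp add: g_def)
        moreover have "norm (h x - g x) < c * \<kappa> * r" "norm (h y - g y) < c * \<kappa> * r"
          using norm_diff_le_mdist_nonexpansive_space[OF \<open>bounded C\<close> gM h(1)] h(2) xy
          by (force intro: le_less_trans)+
        moreover have "norm (g y - g x) \<le> norm (h y - h x) + norm (h x - g x) + norm (h y - g y)"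
          using norm_triangle_ineq4[of "(h y - h x) + (h x - g x)" "h y - g y"]
            norm_triangle_ineq[of "h y - h x" "h x - g x"] by simp
        moreover have "norm (h y - h x) \<le> \<beta> * (\<kappa> * r)" using z(2)[OF xy(1,2)] xy(3) by simp
        moreover have "c * \<kappa> * r + c * \<kappa> * r + \<beta> * (\<kappa> * r) = \<kappa> * r"
          by (simp add: c_def field_simps)
        ultimately show False by linarith
      qed
      ultimately show "h \<in> mball_of ?M f r - ?P" using f h by simp
    qed
    moreover have "0 < c * \<kappa> * r" using c \<kappa> r by simp
    ultimately show ?thesis unfolding porosity_radius_def using gM by (intro Sup_upper) blast
  qed
  then have "lower_porous_at ?M ?P f" if "f \<in> mspace ?M" for f
    using that c \<kappa> e by (intro lower_porous_atI[of "c * \<kappa>" e]) auto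
  then show ?thesis by (auto simp: lower_porous_def locally_contracting_def)
qed

section \<open>Residuality of the points of local Lipschitz constant one\<close>

lemma nowhere_dense_in_subset:
  assumes "nowhere_dense_in X A" "B \<subseteq> A"
  shows "nowhere_dense_in X B"
proof -
  have "X interior_of (X closure_of B) \<subseteq> X interior_of (X closure_of A)"
    by (intro interior_of_mono closure_of_mono assms)
  then show ?thesis using assms by (auto simp: nowhere_dense_in_def)
qed

definition steep_points :: "'a::real_normed_vector set \<Rightarrow> ('a \<Rightarrow> 'a) \<Rightarrow> real \<Rightarrow> real \<Rightarrow> 'a set" where
  "steep_points C f \<beta> \<epsilon> = {x \<in> C. \<exists>y\<in>C. 0 < norm (y - x) \<and> norm (y - x) < \<epsilon> \<and>
     \<beta> * norm (y - x) < norm (f y - f x)}"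

text \<open>For a fixed witness \<open>y\<close> the conditions on \<open>x\<close> are strict
  inequalities between continuous functions; the union over \<open>y\<close> is open.\<close>

lemma openin_steep_points:
  assumes "continuous_on C f"
  shows "openin (top_of_set C) (steep_points C f \<beta> \<epsilon>)"
proof -
  define h where "h y x = min (norm (y - x)) (min (\<epsilon> - norm (y - x))
    (norm (f y - f x) - \<beta> * norm (y - x)))" for x y
  have "continuous_on C (h y)" for y
    unfolding h_def by (intro continuous_intros assms)
  then have "openin (top_of_set C) (C \<inter> h y -` {0<..})" for y
    by (intro continuous_openin_preimage_gen) auto
  then have "openin (top_of_set C) (\<Union>y\<in>C. C \<inter> h y -` {0<..})" by blast
  also have "(\<Union>y\<in>C. C \<inter> h y -` {0<..}) = steep_points C f \<beta> \<epsilon>"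
    by (auto simp: steep_points_def h_def)
  finally show ?thesis .
qed

text \<open>Quotients arbitrarily close to 1 occur at arbitrarily small distances, so
  \<open>lip_sup\<close> is 1 at every positive radius, even before the limit.\<close>

lemma Lip_eq_1:
  assumes f: "\<And>y. y \<in> C \<Longrightarrow> norm (f y - f x) \<le> norm (y - x)"
    and steep: "\<And>n. x \<in> steep_points C f (1 - inverse (Suc n)) (inverse (Suc n))"
  shows "Lip C f x = 1"
proof -
  have "lip_sup C f x r = 1" if "r > 0" for r
  proof (rule antisym)
    show "lip_sup C f x r \<le> 1"
      unfolding lip_sup_def using f by (intro Sup_least) (auto simp: divide_le_eq)
  next
    show "1 \<le> lip_sup C f x r"
    proof (rule dense_le)
      fix t :: ereal assume "t < 1"
      then obtain s where s: "t < ereal s" "ereal s < 1" using ereal_dense2 by blast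
      \<comment> \<open>Below \<open>r\<close> the witness counts for \<open>lip_sup\<close>; below
        \<open>1 - s\<close> its quotient exceeds \<open>s\<close>.\<close>
      then have "0 < min r (1 - s)" using \<open>r > 0\<close> by (simp add: one_ereal_def)
      then obtain n where n: "inverse (real (Suc n)) < min r (1 - s)"
        using reals_Archimedean by blast
      obtain y where y: "y \<in> C" "0 < norm (y - x)" "norm (y - x) < inverse (Suc n)"
        "(1 - inverse (Suc n)) * norm (y - x) < norm (f y - f x)"
        using steep[of n] by (auto simp: steep_points_def)
      have "t \<le> ereal (norm (f y - f x) / norm (y - x))"
      proof -
        have "s < 1 - inverse (Suc n)" using n by simp
        also have "\<dots> < norm (f y - f x) / norm (y - x)" using y by (simp add: less_divide_eq)
        finally show ?thesis using s by (metis ereal_less_eq(3) less_imp_le order_trans)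
      qed
      also have "\<dots> \<le> lip_sup C f x r"
        unfolding lip_sup_def using y n by (intro Sup_upper) force
      finally show "t \<le> lip_sup C f x r" .
    qed
  qed
  then have "\<forall>\<^sub>F r in at_right 0. lip_sup C f x r = 1"
    by (intro eventually_mono[OF eventually_at_right_less]) auto
  then have "(lip_sup C f x \<longlongrightarrow> 1) (at_right 0)" by (rule tendsto_eventually)
  then show ?thesis
    using tendsto_unique[OF trivial_limit_at_right_real lip_sup_tendsto_Lip] by blast
qed

text \<open>If \<open>U\<close> contained no steep point, \<open>f\<close> would have slopes at most
  \<open>\<beta>\<close> at scale \<open>\<epsilon>\<close> in \<open>U\<close>. On a ball
  intersected with \<open>C\<close>, which is convex, this holds at all scales, so \<open>f\<close>
  would be locally contracting.\<close>

lemma steep_points_dense: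
  fixes C :: "'a::real_normed_vector set"
  assumes "convex C" "f \<in> mspace (nonexpansive_space C)"
    and f: "\<And>n. f \<notin> locally_contracting C (1 - inverse (Suc n)) (inverse (Suc n))"
    and U: "openin (top_of_set C) U" "U \<noteq> {}" and "\<beta> < 1" "\<epsilon> > 0"
  shows "U \<inter> steep_points C f \<beta> \<epsilon> \<noteq> {}"
proof
  assume disj: "U \<inter> steep_points C f \<beta> \<epsilon> = {}"
  obtain z where z: "z \<in> U" using U by blast
  then have zC: "z \<in> C" using U openin_imp_subset by blast
  obtain \<eta> where \<eta>: "\<eta> > 0" "C \<inter> ball z \<eta> \<subseteq> U"
    using U(1) z unfolding openin_contains_ball by (metis inf_commute)
  \<comment> \<open>One index controls both the radius, to stay in \<open>U\<close>, and the
    Lipschitz constant, to exceed \<open>\<beta>\<close>.\<close>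
  obtain n where n: "inverse (real (Suc n)) < min \<eta> (1 - \<beta>)"
    using reals_Archimedean[of "min \<eta> (1 - \<beta>)"] \<eta> \<open>\<beta> < 1\<close> by auto
  let ?V = "C \<inter> ball z (inverse (Suc n))"
  have "norm (f y - f x) \<le> (1 - inverse (Suc n)) * norm (y - x)" if xy: "x \<in> ?V" "y \<in> ?V" for x y
  proof (rule convex_lipschitz_local_to_global[of ?V \<epsilon>])
    show "convex ?V" using \<open>convex C\<close> by (intro convex_Int convex_ball)
    fix x y assume xy: "x \<in> ?V" "y \<in> ?V" "norm (y - x) < \<epsilon>"
    then have "x \<in> U" using \<eta> n by auto
    then have "x \<notin> steep_points C f \<beta> \<epsilon>" using disj by blast
    then have "norm (f y - f x) \<le> \<beta> * norm (y - x)"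
      using xy by (cases "x = y") (auto simp: steep_points_def not_less)
    also have "\<dots> \<le> (1 - inverse (Suc n)) * norm (y - x)"
      using n by (intro mult_right_mono) auto
    finally show "norm (f y - f x) \<le> (1 - inverse (Suc n)) * norm (y - x)" .
  qed (use xy \<open>\<epsilon> > 0\<close> in auto)
  then show False using f[of n] assms(2) zC unfolding locally_contracting_def by blast
qed

lemma residual_in_Lip_1:
  fixes C :: "'a::real_normed_vector set"
  assumes "bounded C" "convex C" and fM: "f \<in> mspace (nonexpansive_space C)"
    and f: "\<And>n. f \<notin> locally_contracting C (1 - inverse (Suc n)) (inverse (Suc n))"
  shows "residual_in (top_of_set C) {x \<in> C. Lip C f x = 1}"
proof -
  have f1: "\<And>x y. x \<in> C \<Longrightarrow> y \<in> C \<Longrightarrow> norm (f y - f x) \<le> norm (y - x)"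
    using fM \<open>bounded C\<close> by (auto simp: mspace_nonexpansive_space)
  then have "1-lipschitz_on C f"
    by (auto simp: lipschitz_on_def dist_norm norm_minus_commute)
  then have cont: "continuous_on C f" by (rule lipschitz_on_continuous_on)
  define S where "S n = steep_points C f (1 - inverse (Suc n)) (inverse (Suc n))" for n
  define R where "R = {x \<in> C. Lip C f x = 1}"
  have "nowhere_dense_in (top_of_set C) (C - S n)" for n
  proof -
    have "closedin (top_of_set C) (C - S n)"
      unfolding S_def by (intro closedin_diff openin_steep_points cont) auto
    moreover have "top_of_set C interior_of (C - S n) = {}"
      unfolding interior_of_eq_empty
    proof (intro allI impI, elim conjE)
      fix U assume "openin (top_of_set C) U" "U \<subseteq> C - S n"
      then show "U = {}"
        using steep_points_dense[OF \<open>convex C\<close> fM f, of U "1 - inverse (Suc n)" "inverse (Suc n)"]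
        by (auto simp: S_def)
    qed
    ultimately show ?thesis by (simp add: nowhere_dense_in_def closure_of_closedin)
  qed
  \<comment> \<open>Residuality asks that the complement equal the union, while the sets
    \<open>C - S n\<close> are only shown to cover it; hence \<open>R\<close> is removed from
    each.\<close>
  then have "nowhere_dense_in (top_of_set C) (C - S n - R)" for n
    by (rule nowhere_dense_in_subset) blast
  moreover have "C - R = (\<Union>n. C - S n - R)"
  proof -
    have "x \<in> R" if "x \<in> C" "\<And>n. x \<in> S n" for x
      using that Lip_eq_1[of C f x, OF f1[OF \<open>x \<in> C\<close>]] unfolding R_def S_def by blast
    then show ?thesis by blast
  qed
  ultimately show ?thesis
    unfolding residual_in_def R_def[symmetric]
    by (intro conjI exI[of _ "range (\<lambda>n. C - S n - R)"]) (auto simp: R_def)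
qed

theorem theorem1p2:
  fixes C :: "'a::banach set"
  assumes "closed C" and "bounded C" and "convex C"
    and "C \<noteq> {}" and "\<not> is_singleton C"
  shows "\<exists>N. N \<subseteq> mspace (nonexpansive_space C) \<and> sigma_lower_porous (nonexpansive_space C) N \<and>
    (\<forall>f \<in> mspace (nonexpansive_space C) - N.
       residual_in (top_of_set C) {x \<in> C. Lip C f x = 1})"
proof -
  \<comment> \<open>A single index suffices, since \<open>locally_contracting\<close> grows as
    \<open>\<beta>\<close> increases and \<open>\<rho>\<close> decreases.\<close>
  define P where "P n = locally_contracting C (1 - inverse (Suc n)) (inverse (Suc n))" for n
  have "inverse (real (Suc n)) \<le> 1" for n by (simp add: field_simps)
  then have "lower_porous (nonexpansive_space C) (P n)" for n
    unfolding P_def using assms by (intro lower_porous_locally_contracting) auto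
  then have "sigma_lower_porous (nonexpansive_space C) (\<Union>n. P n)"
    unfolding sigma_lower_porous_def by (intro exI[of _ "range P"]) auto
  moreover have "(\<Union>n. P n) \<subseteq> mspace (nonexpansive_space C)"
    by (auto simp: P_def locally_contracting_def)
  moreover have "residual_in (top_of_set C) {x \<in> C. Lip C f x = 1}"
    if "f \<in> mspace (nonexpansive_space C) - (\<Union>n. P n)" for f
    using that assms by (intro residual_in_Lip_1) (auto simp: P_def)
  ultimately show ?thesis by blast
qed

end
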